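(* Let $m,n$ be positive integers and let $R$ be an $(m,n)$-regularly nil clean ring. Then for every $a\in R$ there exists an idempotent $f\in a^nRa^m$ such that $a^n(1-f)a^m$ is nilpotent.
   Context: All rings are associative with identity (not necessarily commutative). For non-negative integers $m,n$, a ring $R$ is called $(m,n)$-regularly nil clean if for every $a\in R$ there exists an idempotent $e\in a^mRa^n$ such that $a^m(1-e)a^n$ is nilpotent. *)

theory Defs
  imports "HOL-Algebra.Ring"
begin

context ring
begin

definition idem :: "'a \<Rightarrow> bool" where
  "idem e \<longleftrightarrow> e \<in> carrier R \<and> e \<otimes> e = e"

definition nilpotent :: "'a \<Rightarrow> bool" where
  "nilpotent x \<longleftrightarrow> x \<in> carrier R \<and> (\<exists>k::nat. k > 0 \<and> x [^] k = \<zero>)"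

text \<open>The set \<open>x R y\<close> consists of the single products \<open>x r y\<close>, not of sums of such products.\<close>

definition sandwich :: "'a \<Rightarrow> 'a \<Rightarrow> 'a set" where
  "sandwich x y = {x \<otimes> r \<otimes> y | r. r \<in> carrier R}"

end

text \<open>The locale \<^locale>\<open>ring\<close> is that of associative unital rings, not necessarily
  commutative; the zero ring is included.  The exponents may be zero, with \<open>a\<^sup>0 = 1\<close>.\<close>

definition regularly_nil_clean :: "nat \<Rightarrow> nat \<Rightarrow> ('a, 'b) ring_scheme \<Rightarrow> bool" where
  "regularly_nil_clean m n R \<longleftrightarrow> ring R \<and>
     (\<forall>a \<in> carrier R. \<exists>e \<in> ring.sandwich R (a [^]\<^bsub>R\<^esub> m) (a [^]\<^bsub>R\<^esub> n).
        ring.idem R e \<and>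
        ring.nilpotent R (a [^]\<^bsub>R\<^esub> m \<otimes>\<^bsub>R\<^esub> (\<one>\<^bsub>R\<^esub> \<ominus>\<^bsub>R\<^esub> e) \<otimes>\<^bsub>R\<^esub> a [^]\<^bsub>R\<^esub> n))"

end

theory Submission
  imports Defs
begin

text \<open>Let \<open>e = a\<^sup>m r a\<^sup>n\<close> be the given idempotent.  If \<open>e = x y\<close>, then \<open>f = y e x\<close> is idempotent
  with \<open>x (1 - f) = (1 - e) x\<close> and \<open>(1 - f) y = y (1 - e)\<close>.  Choosing \<open>y = a\<^sup>n\<^sup>-\<^sup>m\<close>,
  \<open>x = a\<^sup>m r a\<^sup>m\<close> when \<open>m \<le> n\<close>, and \<open>x = a\<^sup>m\<^sup>-\<^sup>n\<close>, \<open>y = a\<^sup>n r a\<^sup>n\<close> otherwise, \<open>f\<close> lies in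
  \<open>a\<^sup>n R a\<^sup>m\<close>.  Since \<open>u v\<close> is nilpotent iff \<open>v u\<close> is, both nilpotency conditions only concern
  \<open>a\<^sup>m\<^sup>+\<^sup>n (1 - e)\<close> and \<open>a\<^sup>m\<^sup>+\<^sup>n (1 - f)\<close>, and the relations above carry one into the other.\<close>

context ring
begin

lemma pow_Suc_mult_swap:
  assumes [simp]: "x \<in> carrier R" "y \<in> carrier R"
  shows "(y \<otimes> x) [^] Suc k = y \<otimes> (x \<otimes> y) [^] k \<otimes> x"
proof (induction k)
  case (Suc k)
  have "(y \<otimes> x) [^] Suc (Suc k) = (y \<otimes> (x \<otimes> y) [^] k \<otimes> x) \<otimes> (y \<otimes> x)"
    using Suc by simp
  then show ?case by (simp add: m_assoc)
qed simp

text \<open>If \<open>(u \<otimes> v) [^] k\<close> vanishes, regrouping gives \<open>(v \<otimes>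
  u) [^] Suc k = v \<otimes> (u \<otimes> v) [^] k \<otimes> u\<close>, which vanishes too, and
  \<open>Suc k\<close> is positive.\<close>

lemma nilpotent_mult_swap:
  assumes "x \<in> carrier R" "y \<in> carrier R"
  shows "nilpotent (x \<otimes> y) \<longleftrightarrow> nilpotent (y \<otimes> x)"
proof -
  have "nilpotent (v \<otimes> u)"
    if nil: "nilpotent (u \<otimes> v)" and [simp]: "u \<in> carrier R" "v \<in> carrier R" for u v
  proof -
    from nil obtain k :: nat where "(u \<otimes> v) [^] k = \<zero>"
      by (auto simp: nilpotent_def)
    then have "(v \<otimes> u) [^] Suc k = \<zero>"
      unfolding pow_Suc_mult_swap[OF that(2,3)] by simp
    then show ?thesis
      unfolding nilpotent_def using that(2,3) zero_less_Suc by blast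
  qed
  then show ?thesis using assms by blast
qed

lemma nilpotent_mult_rotate:
  assumes [simp]: "u \<in> carrier R" "z \<in> carrier R" "v \<in> carrier R"
  shows "nilpotent (u \<otimes> z \<otimes> v) \<longleftrightarrow> nilpotent (v \<otimes> u \<otimes> z)"
  using nilpotent_mult_swap[of "u \<otimes> z" v] by (simp add: m_assoc)

text \<open>In the square, the inner \<open>x\<close> and \<open>y\<close> meet and form a third
  copy of \<open>x \<otimes> y\<close>; idempotence collapses the three copies to one.\<close>

lemma idem_swap:
  assumes e: "idem (x \<otimes> y)" and [simp]: "x \<in> carrier R" "y \<in> carrier R"
  shows "idem (y \<otimes> (x \<otimes> y) \<otimes> x)"
proof -
  let ?e = "x \<otimes> y"
  have ee: "?e \<otimes> ?e = ?e" using e by (simp add: idem_def)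
  have "(y \<otimes> ?e \<otimes> x) \<otimes> (y \<otimes> ?e \<otimes> x) = y \<otimes> (?e \<otimes> ?e \<otimes> ?e) \<otimes> x"
    by (simp add: m_assoc)
  then show ?thesis
    unfolding ee by (simp add: idem_def)
qed

lemma minus_idem_swap:
  assumes e: "idem (x \<otimes> y)" and [simp]: "x \<in> carrier R" "y \<in> carrier R"
  shows "x \<otimes> (\<one> \<ominus> y \<otimes> (x \<otimes> y) \<otimes> x) = (\<one> \<ominus> x \<otimes> y) \<otimes> x"
    and "(\<one> \<ominus> y \<otimes> (x \<otimes> y) \<otimes> x) \<otimes> y = y \<otimes> (\<one> \<ominus> x \<otimes> y)"
proof -
  let ?e = "x \<otimes> y"
  have ee: "?e \<otimes> ?e = ?e" using e by (simp add: idem_def)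
  have "x \<otimes> (y \<otimes> ?e \<otimes> x) = (?e \<otimes> ?e) \<otimes> x" "(y \<otimes> ?e \<otimes> x) \<otimes> y = y \<otimes> (?e \<otimes> ?e)"
    by (simp_all add: m_assoc)
  then have "x \<otimes> (y \<otimes> ?e \<otimes> x) = ?e \<otimes> x" "(y \<otimes> ?e \<otimes> x) \<otimes> y = y \<otimes> ?e"
    unfolding ee .
  then show "x \<otimes> (\<one> \<ominus> y \<otimes> ?e \<otimes> x) = (\<one> \<ominus> ?e) \<otimes> x"
    "(\<one> \<ominus> y \<otimes> ?e \<otimes> x) \<otimes> y = y \<otimes> (\<one> \<ominus> ?e)"
    by (simp_all add: minus_eq l_distr r_distr l_minus r_minus)
qed

text \<open>With e = xy and f = yex, cx(1 - f) = c(1 - e)x. Rotating the last x to the front gives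
  xc(1 - e), which is cx(1 - e) since x and c commute.\<close>

lemma nilpotent_idem_swap_left:
  assumes "idem (x \<otimes> y)" and [simp]: "x \<in> carrier R" "y \<in> carrier R" "c \<in> carrier R"
    and comm: "x \<otimes> c = c \<otimes> x"
    and nil: "nilpotent (c \<otimes> x \<otimes> (\<one> \<ominus> x \<otimes> y))"
  shows "nilpotent (c \<otimes> x \<otimes> (\<one> \<ominus> y \<otimes> (x \<otimes> y) \<otimes> x))"
proof -
  have "nilpotent (c \<otimes> (\<one> \<ominus> x \<otimes> y) \<otimes> x)"
    using nil comm by (simp add: nilpotent_mult_rotate)
  then show ?thesis
    using minus_idem_swap(1)[OF assms(1-3)] by (simp add: m_assoc)
qed

text \<open>Mirror image: cy(1 - e) rotates to y(1 - e)c = (1 - f)yc, and swapping the two factors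
  gives yc(1 - f) = cy(1 - f).\<close>

lemma nilpotent_idem_swap_right:
  assumes "idem (x \<otimes> y)" and [simp]: "x \<in> carrier R" "y \<in> carrier R" "c \<in> carrier R"
    and comm: "y \<otimes> c = c \<otimes> y"
    and nil: "nilpotent (c \<otimes> y \<otimes> (\<one> \<ominus> x \<otimes> y))"
  shows "nilpotent (c \<otimes> y \<otimes> (\<one> \<ominus> y \<otimes> (x \<otimes> y) \<otimes> x))"
proof -
  let ?f = "y \<otimes> (x \<otimes> y) \<otimes> x"
  have "nilpotent (y \<otimes> (\<one> \<ominus> x \<otimes> y) \<otimes> c)"
    using nil by (simp add: nilpotent_mult_rotate)
  then have "nilpotent ((\<one> \<ominus> ?f) \<otimes> (y \<otimes> c))"
    using minus_idem_swap(2)[OF assms(1-3)] by (simp flip: m_assoc)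
  then show ?thesis
    using nilpotent_mult_swap[of "\<one> \<ominus> ?f" "y \<otimes> c"] comm by simp
qed

lemma sandwich_idem_swap:
  fixes m n :: nat
  assumes a [simp]: "a \<in> carrier R"
    and e: "e \<in> sandwich (a [^] m) (a [^] n)" "idem e"
    and nil: "nilpotent (a [^] m \<otimes> (\<one> \<ominus> e) \<otimes> a [^] n)"
  shows "\<exists>f \<in> sandwich (a [^] n) (a [^] m).
    idem f \<and> nilpotent (a [^] n \<otimes> (\<one> \<ominus> f) \<otimes> a [^] m)"
proof -
  obtain r where r [simp]: "r \<in> carrier R" and e_eq: "e = a [^] m \<otimes> r \<otimes> a [^] n"
    using e(1) by (auto simp: sandwich_def)
  have e_carrier [simp]: "e \<in> carrier R" using e(2) by (simp add: idem_def)
  \<comment> \<open>Rotating the right-hand power to the front merges both powers into one.\<close>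
  have nil': "nilpotent (a [^] (n + m) \<otimes> (\<one> \<ominus> e))"
    using nil by (simp add: nilpotent_mult_rotate nat_pow_mult)
  have "\<exists>f \<in> sandwich (a [^] n) (a [^] m).
    idem f \<and> nilpotent (a [^] (n + m) \<otimes> (\<one> \<ominus> f))"
  proof (cases "m \<le> n")
    case True
    define x where "x = a [^] m \<otimes> r \<otimes> a [^] m"
    define y where "y = a [^] (n - m)"
    have [simp]: "x \<in> carrier R" "y \<in> carrier R" by (simp_all add: x_def y_def)
    have xy: "e = x \<otimes> y"
      using True by (simp add: e_eq x_def y_def m_assoc nat_pow_mult)
    \<comment> \<open>Here \<open>y\<close> is a power of \<open>a\<close>, so it commutes with
      \<open>c = a [^] (m + m)\<close> and \<open>c \<otimes> y\<close> is the full power: the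
      setting of the right-hand transfer.\<close>
    have pow: "a [^] (n + m) = a [^] (m + m) \<otimes> y" "y \<otimes> a [^] (m + m) = a [^] (m + m) \<otimes> y"
      using True by (simp_all add: y_def nat_pow_mult add.commute)
    have "y \<otimes> a [^] m = a [^] n"
      using True by (simp add: y_def nat_pow_mult)
    then have "y \<otimes> (x \<otimes> y) \<otimes> x = a [^] n \<otimes> (r \<otimes> a [^] m \<otimes> y \<otimes> a [^] m \<otimes> r) \<otimes> a [^] m"
      by (simp add: x_def flip: m_assoc)
    then have "y \<otimes> (x \<otimes> y) \<otimes> x \<in> sandwich (a [^] n) (a [^] m)"
      unfolding sandwich_def by fastforce
    then show ?thesis
      using idem_swap[of x y] nilpotent_idem_swap_right[of x y "a [^] (m + m)"] e(2) nil' pow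
      unfolding xy by auto
  next
    case False
    define x where "x = a [^] (m - n)"
    define y where "y = a [^] n \<otimes> r \<otimes> a [^] n"
    have [simp]: "x \<in> carrier R" "y \<in> carrier R" by (simp_all add: x_def y_def)
    have xy: "e = x \<otimes> y"
      using False by (simp add: e_eq x_def y_def nat_pow_mult flip: m_assoc)
    \<comment> \<open>Now \<open>x\<close> is the power of \<open>a\<close>, so the left-hand
      transfer applies with \<open>c = a [^] (n + n)\<close>.\<close>
    have pow: "a [^] (n + m) = a [^] (n + n) \<otimes> x" "x \<otimes> a [^] (n + n) = a [^] (n + n) \<otimes> x"
      using False by (simp_all add: x_def nat_pow_mult add.commute)
    \<comment> \<open>The final \<open>a [^] n \<otimes> x\<close> is kept together because it
      supplies the right end \<open>a [^] m\<close> of the sandwich.\<close>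
    have "y \<otimes> (x \<otimes> y) \<otimes> x = a [^] n \<otimes> (r \<otimes> a [^] n \<otimes> x \<otimes> a [^] n \<otimes> r) \<otimes> (a [^] n \<otimes> x)"
      by (simp add: y_def m_assoc)
    also have "a [^] n \<otimes> x = a [^] m"
      using False by (simp add: x_def nat_pow_mult)
    finally have "y \<otimes> (x \<otimes> y) \<otimes> x = a [^] n \<otimes> (r \<otimes> a [^] n \<otimes> x \<otimes> a [^] n \<otimes> r) \<otimes> a [^] m" .
    then have "y \<otimes> (x \<otimes> y) \<otimes> x \<in> sandwich (a [^] n) (a [^] m)"
      unfolding sandwich_def by fastforce
    then show ?thesis
      using idem_swap[of x y] nilpotent_idem_swap_left[of x y "a [^] (n + n)"] e(2) nil' pow
      unfolding xy by auto
  qed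
  then obtain f where f: "f \<in> sandwich (a [^] n) (a [^] m)" "idem f"
    and nil_f: "nilpotent (a [^] (n + m) \<otimes> (\<one> \<ominus> f))" by blast
  have "f \<in> carrier R" using f(2) by (simp add: idem_def)
  \<comment> \<open>Rotating back splits the power again, now with exponent \<open>n\<close> on the
    left and \<open>m\<close> on the right.\<close>
  then have "nilpotent (a [^] n \<otimes> (\<one> \<ominus> f) \<otimes> a [^] m)"
    using nil_f by (simp add: nilpotent_mult_rotate nat_pow_mult add.commute)
  then show ?thesis using f by blast
qed

end

theorem proposition2p1:
  fixes R (structure) and m n :: nat
  assumes "ring R" and "m > 0" and "n > 0"
    and "regularly_nil_clean m n R"
  shows "\<forall>a \<in> carrier R. \<exists>f \<in> ring.sandwich R (a [^] n) (a [^] m).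
           ring.idem R f \<and>
           ring.nilpotent R (a [^] n \<otimes> (\<one> \<ominus> f) \<otimes> a [^] m)"
  using assms(4) ring.sandwich_idem_swap[OF assms(1)]
  unfolding regularly_nil_clean_def by blast

end
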